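(* Let $\alpha := \frac14$, $\beta \in (0,1)$, $c \in (0,\frac58]$ and $\Delta := 1$, and let $f : \mathbb{R}^{2\times 2} \to \mathbb{R}$ be defined by $$f(X) := \frac{(X_{1,1}-4)^2 + 3(X_{2,2}-2)^2 + (X_{1,2}-X_{2,1})^2}{2}.$$ Consider the minimization of $f$ on $\mathbb{R}^{2\times 2}_{\le 1}$. Starting from $X_0 := \operatorname{diag}(1,0)$ and using $\bar\alpha := \underline{\alpha} := \alpha$, $\beta$, $c$ and $\Delta$, the algorithm $\mathrm{P}^2\mathrm{GDR}$ produces the sequence $(X_i)_{i\in\mathbb{N}}$ defined by $X_i := \operatorname{diag}(0, 2-2(1-3\alpha)^i)$ for every $i \in \mathbb{N}\setminus\{0\}$. In particular, $(X_i)_{i\in\mathbb{N}}$ converges to $\operatorname{diag}(0,2)$, $\lim_{i\to\infty} \mathrm{s}_f(X_i) = 0$, and $\mathrm{s}_f(\operatorname{diag}(0,2)) = 0$.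
   Context: $\mathbb{N}$ includes $0$. $\mathbb{R}^{2\times 2}$ carries the Frobenius inner product and $\|\cdot\|$ is the Frobenius norm; gradients are taken with respect to this inner product. $\mathbb{R}^{2\times 2}_{\le 1} := \{X \in \mathbb{R}^{2\times 2} \mid \operatorname{rank} X \le 1\}$ and, for an integer $s \ge 0$, $\mathbb{R}^{2\times 2}_{s} := \{X \in \mathbb{R}^{2\times 2} \mid \operatorname{rank} X = s\}$. For a nonempty set $\mathcal{S} \subseteq \mathbb{R}^{2\times 2}$ and $X \in \mathbb{R}^{2\times 2}$, $P_{\mathcal{S}}(X) := \operatorname{argmin}_{Y\in\mathcal{S}} \|X-Y\|$ (a set, identified with its element when it is a singleton). For $X \in \mathcal{S}$, the tangent cone $T_{\mathcal{S}}(X)$ is the set of all $V \in \mathbb{R}^{2\times 2}$ for which there exist $(t_i)_{i\in\mathbb{N}}$ in $(0,\infty)$ converging to $0$ and $(V_i)_{i\in\mathbb{N}}$ in $\mathbb{R}^{2\times 2}$ converging to $V$ such that $X+t_iV_i \in \mathcal{S}$ for every $i$; it is a closed cone, and for a closed cone $\mathcal{C}$ all elements of $P_{\mathcal{C}}(X)$ have the same norm. Stationarity measure: for $X \in \mathbb{R}^{2\times 2}_{\le 1}$, $\mathrm{s}_f(X) := \|P_{T_{\mathbb{R}^{2\times 2}_{\le 1}}(X)}(-\nabla f(X))\|$ (norm of any element of this projection). $\Delta$-rank: for $X \ne 0$ with singular values $\sigma_1(X) \ge \sigma_2(X)$, $\operatorname{rank}_\Delta X := \max\{j \in \{1,\dots,\operatorname{rank}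 X\} \mid \sigma_j(X) > \Delta\}$, with the convention that the maximum of the empty set is $0$; $\operatorname{rank}_\Delta 0_{2\times 2} := 0$. $\mathrm{P}^2\mathrm{GD}$ map with parameters $0 < \underline{\alpha} \le \bar\alpha < \infty$, $\beta, c \in (0,1)$: given $X \in \mathbb{R}^{2\times 2}_{\le 1}$ with $\mathrm{s}_f(X) > 0$, choose $G \in P_{T_{\mathbb{R}^{2\times 2}_{\le 1}}(X)}(-\nabla f(X))$, a step size $\alpha \in [\underline{\alpha},\bar\alpha]$, and $Y \in P_{\mathbb{R}^{2\times 2}_{\le 1}}(X+\alpha G)$; while $f(Y) > f(X) - c\,\alpha\,\mathrm{s}_f(X)^2$, replace $\alpha$ by $\alpha\beta$ and choose a new $Y \in P_{\mathbb{R}^{2\times 2}_{\le 1}}(X+\alpha G)$; then return $Y$. The set of all possible outputs is $\mathrm{P}^2\mathrm{GD}(X; f,\underline{\alpha},\bar\alpha,\beta,c)$. $\mathrm{P}^2\mathrm{GDR}$ map with the same parameters and $\Delta \in (0,\infty)$: given $X \in \mathbb{R}^{2\times 2}_{\le 1}$ with $\mathrm{s}_f(X) > 0$, for each $j \in \{0,\dots,\operatorname{rank} X - \operatorname{rank}_\Delta X\}$ choose $\hat X^j \in P_{\mathbb{R}^{2\times 2}_{\operatorname{rank} X - j}}(X)$ and $\tilde X^j \in \mathrm{P}^2\mathrm{GD}(\hat X^j; f,\underline{\alpha},\bar\alpha,\beta,c)$; then return some $Y$ minimizing $f$ over the finite set of all the $\tilde X^j$. The set of all possible outputs is $\mathrm{P}^2\mathrm{GDR}(X;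 f,\underline{\alpha},\bar\alpha,\beta,c,\Delta)$. The algorithm $\mathrm{P}^2\mathrm{GDR}$ (with stopping tolerance $0$): starting from $X_0 \in \mathbb{R}^{2\times 2}_{\le 1}$, as long as $\mathrm{s}_f(X_i) > 0$, choose $X_{i+1} \in \mathrm{P}^2\mathrm{GDR}(X_i; f,\underline{\alpha},\bar\alpha,\beta,c,\Delta)$. "Produces the sequence $(X_i)$" means that the algorithm never stops and that its iterates are the $X_i$. *)

theory Defs
  imports "HOL-Analysis.Analysis"
begin

text \<open>The library's inner product and norm on \<open>real ^ 2 ^ 2\<close> are the Frobenius inner product and the
  Frobenius norm.\<close>

type_synonym mat2 = "real ^ 2 ^ 2"

definition diag2 :: "real \<Rightarrow> real \<Rightarrow> mat2" where
  "diag2 a b = vector [vector [a, 0], vector [0, b]]"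

definition rank_le1 :: "mat2 set" where
  "rank_le1 = {X. rank X \<le> 1}"

definition rank_eq :: "nat \<Rightarrow> mat2 set" where
  "rank_eq s = {X. rank X = s}"

definition grad :: "('a::real_inner \<Rightarrow> real) \<Rightarrow> 'a \<Rightarrow> 'a" where
  "grad f X = (THE G. GDERIV f X :> G)"

definition proj :: "'a::real_normed_vector set \<Rightarrow> 'a \<Rightarrow> 'a set" where
  "proj S X = {Y. is_arg_min (\<lambda>Y. norm (X - Y)) (\<lambda>Y. Y \<in> S) Y}"

definition tangent_cone :: "'a::real_normed_vector set \<Rightarrow> 'a \<Rightarrow> 'a set" where
  "tangent_cone S X = {V. \<exists>(t :: nat \<Rightarrow> real) W. (\<forall>i. 0 < t i) \<and> t \<longlonglongrightarrow> 0 \<and> W \<longlonglongrightarrow> V \<and>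
     (\<forall>i. X + t i *\<^sub>R W i \<in> S)}"

text \<open>All projections onto a closed cone have the same norm, so the image below is a singleton.\<close>

definition stat_measure :: "(mat2 \<Rightarrow> real) \<Rightarrow> mat2 \<Rightarrow> real" where
  "stat_measure f X = the_elem (norm ` proj (tangent_cone rank_le1 X) (- grad f X))"

definition singular_values :: "mat2 \<Rightarrow> real \<times> real" where
  "singular_values X = (THE (s1, s2). s1 \<ge> s2 \<and> s2 \<ge> 0 \<and>
     (\<exists>U V. orthogonal_matrix U \<and> orthogonal_matrix V \<and> X = U ** diag2 s1 s2 ** transpose V))"

text \<open>Only the indices \<open>j = 1\<close> and \<open>j = 2\<close> are meaningful.\<close>

definition singular_value :: "nat \<Rightarrow> mat2 \<Rightarrow> real" where
  "singular_value j X = (if j = 1 then fst (singular_values X) else snd (singular_values X))"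

text \<open>Inserting \<open>0\<close> implements the convention that the maximum of the empty set is \<open>0\<close>; it also covers
  \<open>X = 0\<close>.\<close>

definition rank_Delta :: "real \<Rightarrow> mat2 \<Rightarrow> nat" where
  "rank_Delta \<Delta> X = Max (insert 0 {j \<in> {1..rank X}. singular_value j X > \<Delta>})"

text \<open>\<open>backtrack f \<beta> c X G \<alpha> Y\<close>: the line search from \<open>X\<close> along \<open>G\<close>, entered with step size \<open>\<alpha>\<close>, can
  return \<open>Y\<close>.  A new projection \<open>Y'\<close> is chosen for each trial step size.\<close>

inductive backtrack ::
  "(mat2 \<Rightarrow> real) \<Rightarrow> real \<Rightarrow> real \<Rightarrow> mat2 \<Rightarrow> mat2 \<Rightarrow> real \<Rightarrow> mat2 \<Rightarrow> bool"
  for f \<beta> c X G where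
  accept: "\<lbrakk>Y \<in> proj rank_le1 (X + \<alpha> *\<^sub>R G); \<not> f Y > f X - c * \<alpha> * (stat_measure f X)\<^sup>2\<rbrakk>
    \<Longrightarrow> backtrack f \<beta> c X G \<alpha> Y"
| shrink: "\<lbrakk>Y' \<in> proj rank_le1 (X + \<alpha> *\<^sub>R G); f Y' > f X - c * \<alpha> * (stat_measure f X)\<^sup>2;
    backtrack f \<beta> c X G (\<alpha> * \<beta>) Y\<rbrakk> \<Longrightarrow> backtrack f \<beta> c X G \<alpha> Y"

text \<open>The two maps below have no output at a point violating the input requirement
  (rank at most one and not stationary).\<close>

definition P2GD ::
  "(mat2 \<Rightarrow> real) \<Rightarrow> real \<Rightarrow> real \<Rightarrow> real \<Rightarrow> real \<Rightarrow> mat2 \<Rightarrow> mat2 set" where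
  "P2GD f \<alpha>lo \<alpha>hi \<beta> c X = {Y. X \<in> rank_le1 \<and> stat_measure f X > 0 \<and>
     (\<exists>G \<in> proj (tangent_cone rank_le1 X) (- grad f X). \<exists>\<alpha> \<in> {\<alpha>lo..\<alpha>hi}.
        backtrack f \<beta> c X G \<alpha> Y)}"

definition P2GDR ::
  "(mat2 \<Rightarrow> real) \<Rightarrow> real \<Rightarrow> real \<Rightarrow> real \<Rightarrow> real \<Rightarrow> real \<Rightarrow> mat2 \<Rightarrow> mat2 set" where
  "P2GDR f \<alpha>lo \<alpha>hi \<beta> c \<Delta> X = {Y. X \<in> rank_le1 \<and> stat_measure f X > 0 \<and>
     (\<exists>Xhat Xtilde.
        (\<forall>j \<in> {0..rank X - rank_Delta \<Delta> X}.
           Xhat j \<in> proj (rank_eq (rank X - j)) X \<and>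
           Xtilde j \<in> P2GD f \<alpha>lo \<alpha>hi \<beta> c (Xhat j)) \<and>
        is_arg_min f (\<lambda>Z. Z \<in> Xtilde ` {0..rank X - rank_Delta \<Delta> X}) Y)}"

text \<open>The algorithm with stopping tolerance \<open>0\<close>, started at \<open>X0\<close>, never stops, and its iterates are
  \<open>X 0, X 1, \<dots>\<close> whatever choices are made: at every iterate the set of possible next iterates
  is exactly the singleton of the next term.\<close>

definition P2GDR_produces ::
  "(mat2 \<Rightarrow> real) \<Rightarrow> real \<Rightarrow> real \<Rightarrow> real \<Rightarrow> real \<Rightarrow> real \<Rightarrow> mat2 \<Rightarrow> (nat \<Rightarrow> mat2) \<Rightarrow> bool" where
  "P2GDR_produces f \<alpha>lo \<alpha>hi \<beta> c \<Delta> X0 X \<longleftrightarrow> X0 \<in> rank_le1 \<and> X 0 = X0 \<and>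
     (\<forall>i. stat_measure f (X i) > 0 \<and> P2GDR f \<alpha>lo \<alpha>hi \<beta> c \<Delta> (X i) = {X (Suc i)})"

end

theory Submission
  imports Defs
begin

text \<open>At \<open>X 0 = diag2 1 0\<close> the singular value \<open>1\<close> does not exceed \<open>\<Delta>\<close>, so the rank reduction to the
  zero matrix is tried as well.  The step from zero, which follows the dominant entry of the
  negative gradient \<open>diag2 4 6\<close>, reaches \<open>diag2 0 (3/2)\<close> and beats the step from \<open>X 0\<close>, which reaches
  \<open>diag2 (7/4) 0\<close>.  From then on the singular value exceeds \<open>\<Delta>\<close>, no reduction is tried, and the
  tangent cone confines the iteration to the line of the matrices \<open>diag2 0 b\<close>, on which it is a
  gradient descent for the quadratic \<open>3 (b - 2)\<^sup>2 / 2\<close>.  All projections are unique, and \<open>c \<le> 5/8\<close> is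
  exactly what makes every line search accept its first step size.\<close>

section \<open>Two by two matrices\<close>

lemma diag2_nth [simp]:
  "diag2 a b $ 1 $ 1 = a" "diag2 a b $ 1 $ 2 = 0" "diag2 a b $ 2 $ 1 = 0" "diag2 a b $ 2 $ 2 = b"
  by (simp_all add: diag2_def)

lemma mat2_eq_iff:
  "X = Y \<longleftrightarrow> X $ 1 $ 1 = Y $ 1 $ 1 \<and> X $ 1 $ 2 = Y $ 1 $ 2 \<and> X $ 2 $ 1 = Y $ 2 $ 1 \<and> X $ 2 $ 2 = Y $ 2 $ 2"
  for X Y :: "'a ^ 2 ^ 2"
  by (auto simp: vec_eq_iff forall_2)

lemma norm_mat2_power2:
  "(norm X)\<^sup>2 = (X $ 1 $ 1)\<^sup>2 + (X $ 1 $ 2)\<^sup>2 + (X $ 2 $ 1)\<^sup>2 + (X $ 2 $ 2)\<^sup>2" for X :: mat2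
  unfolding power2_norm_eq_inner by (simp add: inner_vec_def sum_2 power2_eq_square)

text \<open>The hypothesis makes one entry vanish, so a single formula serves both diagonal
  axes.\<close>

lemma norm_diag2:
  assumes "a * b = 0"
  shows "norm (diag2 a b) = \<bar>a + b\<bar>"
proof -
  have "(norm (diag2 a b))\<^sup>2 = \<bar>a + b\<bar>\<^sup>2"
    using assms by (auto simp: norm_mat2_power2)
  then show ?thesis
    by (rule power2_eq_imp_eq) auto
qed

lemma mem_rank_le1_iff: "X \<in> rank_le1 \<longleftrightarrow> det X = 0"
  using det_eq_0_rank[of X] by (auto simp: rank_le1_def)

lemma rank_mat2_eq_1: "rank X = 1" if "det X = 0" "X \<noteq> 0" for X :: mat2
  using that det_eq_0_rank[of X] rank_eq_0[of X] by simp

text \<open>\<open>singular_values\<close> is a definite description, so uniqueness must be shown: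
  the determinant forces the smaller value to vanish, and the trace of
  \<open>X ** transpose X\<close> then determines the larger one.\<close>

lemma singular_values_eqI:
  assumes "det X = 0" "0 \<le> s" "orthogonal_matrix U" "orthogonal_matrix V"
    and "X = U ** diag2 s 0 ** transpose V"
  shows "singular_values X = (s, 0)"
proof -
  have trace_eq: "trace (Y ** transpose Y) = s1\<^sup>2 + s2\<^sup>2"
    if "orthogonal_matrix P" "orthogonal_matrix Q" "Y = P ** diag2 s1 s2 ** transpose Q"
    for s1 s2 P Q Y
  proof -
    have "Y ** transpose Y = P ** (diag2 s1 s2 ** (transpose Q ** Q) ** transpose (diag2 s1 s2) ** transpose P)"
      using that by (simp add: matrix_transpose_mul matrix_mul_assoc)
    also have "\<dots> = P ** (diag2 s1 s2 ** transpose (diag2 s1 s2) ** transpose P)"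
      using that by (simp add: orthogonal_matrix)
    also have "trace \<dots> = trace (diag2 s1 s2 ** transpose (diag2 s1 s2) ** (transpose P ** P))"
      by (subst trace_mul_sym) (simp add: matrix_mul_assoc)
    also have "\<dots> = s1\<^sup>2 + s2\<^sup>2"
      using that(1) unfolding orthogonal_matrix
      by (simp only: matrix_mul_rid)
        (simp add: trace_def sum_2 matrix_matrix_mult_def transpose_def power2_eq_square)
    finally show ?thesis .
  qed
  show ?thesis
    unfolding singular_values_def
  proof (rule the_equality, goal_cases)
    case 1
    then show ?case using assms by auto
  next
    case (2 r)
    obtain s1 s2 where r: "r = (s1, s2)" by (cases r)
    from 2 obtain P Q where le: "s2 \<le> s1" "0 \<le> s2"
      and PQ: "orthogonal_matrix P" "orthogonal_matrix Q" "X = P ** diag2 s1 s2 ** transpose Q"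
      unfolding r by auto
    have "det P \<noteq> 0" "det Q \<noteq> 0"
      using det_orthogonal_matrix[OF PQ(1)] det_orthogonal_matrix[OF PQ(2)] by auto
    then have "s1 * s2 = 0"
      using assms(1) det_2[of "diag2 s1 s2"] by (simp add: PQ(3) det_mul)
    with le have s2: "s2 = 0" by auto
    have "s1\<^sup>2 = s\<^sup>2"
      using trace_eq[OF PQ] trace_eq[OF assms(3-5)] s2 by simp
    with le assms(2) s2 have "s1 = s" by (auto intro: power2_eq_imp_eq)
    with s2 r show ?case by simp
  qed
qed

lemma singular_values_diag2_left:
  assumes "0 \<le> a"
  shows "singular_values (diag2 a 0) = (a, 0)"
  by (rule singular_values_eqI[of _ _ "mat 1" "mat 1"])
    (use assms in \<open>auto simp: det_2 orthogonal_matrix_id transpose_mat\<close>)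

lemma singular_values_diag2_right:
  assumes "0 \<le> b"
  shows "singular_values (diag2 0 b) = (b, 0)"
proof -
  \<comment> \<open>The swap matrix moves \<open>b\<close> to the leading position, as the ordering
    of the singular values requires.\<close>
  define P :: mat2 where "P = vector [vector [0, 1], vector [1, 0]]"
  have [simp]: "P $ 1 $ 1 = 0" "P $ 1 $ 2 = 1" "P $ 2 $ 1 = 1" "P $ 2 $ 2 = 0"
    by (simp_all add: P_def)
  show ?thesis
    by (rule singular_values_eqI[of _ _ P P])
      (use assms in \<open>auto simp: det_2 orthogonal_matrix mat2_eq_iff matrix_matrix_mult_def
        transpose_def sum_2 mat_def\<close>)
qed

section \<open>Projections and tangent cones\<close>

lemma proj_eq_singletonI:
  assumes "Y \<in> S" "\<And>Z. Z \<in> S \<Longrightarrow> Z \<noteq> Y \<Longrightarrow> norm (X - Y) < norm (X - Z)"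
  shows "proj S X = {Y}"
proof -
  have "is_arg_min (\<lambda>Z. norm (X - Z)) (\<lambda>Z. Z \<in> S) Z \<longleftrightarrow> Z = Y" for Z
    unfolding is_arg_min_def using assms by (metis order_less_asym order_less_irrefl)
  then show ?thesis by (simp add: proj_def)
qed

lemma proj_self:
  assumes "X \<in> S"
  shows "proj S X = {X}"
  using assms by (intro proj_eq_singletonI) auto

text \<open>By Pythagoras, any other point of \<open>S\<close> is strictly farther away. This covers
  projections onto linear subspaces.\<close>

lemma proj_eq_if_orthogonal:
  fixes X :: "'a::real_inner"
  assumes "Y \<in> S" "\<And>Z. Z \<in> S \<Longrightarrow> (X - Y) \<bullet> (Y - Z) = 0"
  shows "proj S X = {Y}"
proof (rule proj_eq_singletonI)
  fix Z assume Z: "Z \<in> S" "Z \<noteq> Y"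
  have "(norm (X - Z))\<^sup>2 = (norm (X - Y))\<^sup>2 + (norm (Y - Z))\<^sup>2"
    using norm_add_Pythagorean[of "X - Y" "Y - Z"] assms(2)[OF Z(1)]
    by (simp add: orthogonal_def)
  moreover have "0 < (norm (Y - Z))\<^sup>2" using Z by simp
  ultimately show "norm (X - Y) < norm (X - Z)"
    by (intro power2_less_imp_less[OF _ norm_ge_zero]) linarith
qed (rule assms)

text \<open>A case of the Eckart-Young theorem; the strict inequality \<open>a < b\<close> gives
  uniqueness.\<close>

lemma proj_rank_le1_diag2:
  assumes "0 \<le> a" "a < b"
  shows "proj rank_le1 (diag2 a b) = {diag2 0 b}"
proof (rule proj_eq_singletonI)
  show "diag2 0 b \<in> rank_le1" by (simp add: mem_rank_le1_iff det_2)
next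
  fix Z assume Z: "Z \<in> rank_le1" "Z \<noteq> diag2 0 b"
  define p q r s where "p = Z $ 1 $ 1" and "q = Z $ 1 $ 2" and "r = Z $ 2 $ 1" and "s = Z $ 2 $ 2"
  note pqrs = p_def[symmetric] q_def[symmetric] r_def[symmetric] s_def[symmetric]
  have det: "p * s = q * r"
    using Z(1) by (simp add: mem_rank_le1_iff det_2 pqrs)
  define D where "D = (norm (diag2 a b - Z))\<^sup>2 - (norm (diag2 a b - diag2 0 b))\<^sup>2"
  have D: "D = (a - p)\<^sup>2 + q\<^sup>2 + r\<^sup>2 + (b - s)\<^sup>2 - a\<^sup>2"
    by (simp add: D_def norm_mat2_power2 pqrs)
  \<comment> \<open>The constraint allows replacing \<open>q\<^sup>2 + r\<^sup>2\<close> by \<open>(q - r)\<^sup>2 + 2 p s\<close> or by \<open>(q + r)\<^sup>2 - 2 p s\<close>; the weights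
    are chosen such that the terms linear in \<open>p\<close> cancel.\<close>
  have D1: "D = (p + s - b)\<^sup>2 + 2 * (b - a) * p + (q - r)\<^sup>2"
    unfolding D using det by (simp add: power2_eq_square algebra_simps)
  have D2: "D = (p - s + b)\<^sup>2 - 2 * (a + b) * p + (q + r)\<^sup>2"
    unfolding D using det by (simp add: power2_eq_square algebra_simps)
  have "2 * b * D = (a + b) * D + (b - a) * D" by (simp add: algebra_simps)
  also have "\<dots> = (a + b) * ((p + s - b)\<^sup>2 + (q - r)\<^sup>2) + (b - a) * ((p - s + b)\<^sup>2 + (q + r)\<^sup>2)"
    by (subst D1, subst D2) (simp add: algebra_simps)
  also have "\<dots> > 0"
  proof -
    have "p \<noteq> 0 \<or> q \<noteq> 0 \<or> r \<noteq> 0 \<or> s \<noteq> b"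
      using Z(2) by (auto simp: mat2_eq_iff pqrs)
    \<comment> \<open>Sums and differences of the four expressions recover \<open>p\<close>,
      \<open>s - b\<close>, \<open>q\<close> and \<open>r\<close>.\<close>
    then have "p + s - b \<noteq> 0 \<or> q - r \<noteq> 0 \<or> p - s + b \<noteq> 0 \<or> q + r \<noteq> 0"
      by linarith
    then have "(p + s - b)\<^sup>2 + (q - r)\<^sup>2 > 0 \<or> (p - s + b)\<^sup>2 + (q + r)\<^sup>2 > 0"
      by (simp add: sum_power2_gt_zero_iff)
    moreover have "0 < k * A + l * B" if "0 < k" "0 < l" "0 \<le> A" "0 \<le> B" "0 < A \<or> 0 < B" for k l A B :: real
      using that by (auto intro: add_pos_nonneg add_nonneg_pos)
    ultimately show ?thesis using assms by simp
  qed
  finally have "D > 0" using assms by (simp add: zero_less_mult_iff)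
  then show "norm (diag2 a b - diag2 0 b) < norm (diag2 a b - Z)"
    unfolding D_def by (intro power2_less_imp_less[OF _ norm_ge_zero]) linarith
qed

text \<open>The determinant is homogeneous and continuous, so \<open>rank_le1\<close> is a closed
  cone and hence its own tangent cone at the origin.\<close>

lemma tangent_cone_rank_le1_zero: "tangent_cone rank_le1 0 = rank_le1"
proof (intro equalityI subsetI)
  fix V assume "V \<in> tangent_cone rank_le1 0"
  then obtain t W where t: "\<And>i. 0 < t i" and W: "W \<longlonglongrightarrow> V"
    and mem: "\<And>i. t i *\<^sub>R W i \<in> rank_le1"
    unfolding tangent_cone_def by auto
  have "det (W i) = 0" for i
    using mem[of i] t[of i] by (auto simp: mem_rank_le1_iff det_2 algebra_simps)
  moreover have "(\<lambda>i. det (W i)) \<longlonglongrightarrow> det V"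
    unfolding det_2 by (intro tendsto_intros W)
  ultimately show "V \<in> rank_le1"
    by (simp add: mem_rank_le1_iff LIMSEQ_const_iff)
next
  fix V :: mat2 assume "V \<in> rank_le1"
  then show "V \<in> tangent_cone rank_le1 0"
    unfolding tangent_cone_def
    by (intro CollectI exI[of _ "\<lambda>n. inverse (real (Suc n))"] exI[of _ "\<lambda>_. V"])
      (use LIMSEQ_inverse_real_of_nat in \<open>auto simp: mem_rank_le1_iff det_2 algebra_simps\<close>)
qed

text \<open>The equation is the vanishing of the derivative of \<open>det\<close> at
  \<open>X\<close> in the direction \<open>V\<close>.\<close>

lemma tangent_cone_rank_le1D:
  assumes "V \<in> tangent_cone rank_le1 X" "det X = 0"
  shows "X $ 1 $ 1 * V $ 2 $ 2 + X $ 2 $ 2 * V $ 1 $ 1 = X $ 1 $ 2 * V $ 2 $ 1 + X $ 2 $ 1 * V $ 1 $ 2"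
proof -
  define L where "L V = X $ 1 $ 1 * V $ 2 $ 2 + X $ 2 $ 2 * V $ 1 $ 1 - X $ 1 $ 2 * V $ 2 $ 1 - X $ 2 $ 1 * V $ 1 $ 2"
    for V :: mat2
  from assms(1) obtain t W where t: "\<And>i. 0 < t i" "t \<longlonglongrightarrow> 0" and W: "W \<longlonglongrightarrow> V"
    and mem: "\<And>i. X + t i *\<^sub>R W i \<in> rank_le1"
    unfolding tangent_cone_def by auto
  have "L (W i) + t i * det (W i) = 0" for i
  proof -
    \<comment> \<open>For 2 by 2 matrices the expansion of \<open>det\<close> stops at second order,
      so this is exact.\<close>
    have "t i * (L (W i) + t i * det (W i)) = det (X + t i *\<^sub>R W i) - det X"
      by (simp add: L_def det_2 algebra_simps)
    then show ?thesis
      using mem[of i] t(1)[of i] assms(2) by (simp add: mem_rank_le1_iff)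
  qed
  moreover have "(\<lambda>i. L (W i) + t i * det (W i)) \<longlonglongrightarrow> L V + 0 * det V"
    unfolding L_def det_2 by (intro tendsto_intros W t)
  ultimately show ?thesis
    by (simp add: LIMSEQ_const_iff L_def)
qed

text \<open>Dividing the curve's displacement by \<open>t\<close> leaves \<open>V + t R\<close>,
  which tends to \<open>V\<close>.\<close>

lemma tangent_cone_quadratic_curveI:
  fixes X V R :: "'a::real_normed_vector"
  assumes "\<And>t. 0 < t \<Longrightarrow> X + t *\<^sub>R V + t\<^sup>2 *\<^sub>R R \<in> S"
  shows "V \<in> tangent_cone S X"
  unfolding tangent_cone_def
proof (intro CollectI exI conjI allI)
  let ?t = "\<lambda>n. inverse (real (Suc n))"
  show t: "?t \<longlonglongrightarrow> 0" by (rule LIMSEQ_inverse_real_of_nat)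
  have "(\<lambda>n. V + ?t n *\<^sub>R R) \<longlonglongrightarrow> V + 0 *\<^sub>R R" by (intro tendsto_intros t)
  then show "(\<lambda>n. V + ?t n *\<^sub>R R) \<longlonglongrightarrow> V" by simp
  fix n
  show "0 < ?t n" by simp
  then show "X + ?t n *\<^sub>R (V + ?t n *\<^sub>R R) \<in> S"
    using assms[of "?t n"] by (simp add: scaleR_add_right power2_eq_square add.assoc)
qed

text \<open>In the next two proofs, \<open>X = x y\<^sup>T\<close> and \<open>V = x v\<^sup>T + u y\<^sup>T\<close>, and the curve is
  \<open>(x + t u) (y + t v)\<^sup>T\<close>.\<close>

lemma tangent_cone_rank_le1_diag2_left:
  assumes "a \<noteq> 0"
  shows "tangent_cone rank_le1 (diag2 a 0) = {V. V $ 2 $ 2 = 0}"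
proof (intro equalityI subsetI)
  fix V assume "V \<in> tangent_cone rank_le1 (diag2 a 0)"
  from tangent_cone_rank_le1D[OF this] assms show "V \<in> {V. V $ 2 $ 2 = 0}"
    by (simp add: det_2)
next
  fix V :: mat2 assume V: "V \<in> {V. V $ 2 $ 2 = 0}"
  \<comment> \<open>With x = e1, y = a e1, v the first row of \<open>V\<close> and u = (0,
    \<open>V $ 2 $ 1 / a\<close>), this is u v^T.\<close>
  define R :: mat2 where
    "R = vector [vector [0, 0], vector [V $ 2 $ 1 * V $ 1 $ 1 / a, V $ 2 $ 1 * V $ 1 $ 2 / a]]"
  have "R $ 1 $ 1 = 0" "R $ 1 $ 2 = 0"
    "R $ 2 $ 1 = V $ 2 $ 1 * V $ 1 $ 1 / a" "R $ 2 $ 2 = V $ 2 $ 1 * V $ 1 $ 2 / a"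
    by (simp_all add: R_def)
  note R = this
  have "det (diag2 a 0 + t *\<^sub>R V + t\<^sup>2 *\<^sub>R R) = 0" for t
  proof -
    have "det (diag2 a 0 + t *\<^sub>R V + t\<^sup>2 *\<^sub>R R) =
        t\<^sup>2 * (a * R $ 2 $ 2 - V $ 1 $ 2 * V $ 2 $ 1) + t ^ 3 * (V $ 1 $ 1 * R $ 2 $ 2 - V $ 1 $ 2 * R $ 2 $ 1)"
      using V R(1,2) by (simp add: det_2 algebra_simps power2_eq_square power3_eq_cube)
    also have "\<dots> = 0" using assms by (simp add: R)
    finally show ?thesis .
  qed
  then show "V \<in> tangent_cone rank_le1 (diag2 a 0)"
    by (intro tangent_cone_quadratic_curveI[where R = R]) (simp add: mem_rank_le1_iff)
qed

lemma tangent_cone_rank_le1_diag2_right: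
  assumes "b \<noteq> 0"
  shows "tangent_cone rank_le1 (diag2 0 b) = {V. V $ 1 $ 1 = 0}"
proof (intro equalityI subsetI)
  fix V assume "V \<in> tangent_cone rank_le1 (diag2 0 b)"
  from tangent_cone_rank_le1D[OF this] assms show "V \<in> {V. V $ 1 $ 1 = 0}"
    by (simp add: det_2)
next
  fix V :: mat2 assume V: "V \<in> {V. V $ 1 $ 1 = 0}"
  \<comment> \<open>Again u v^T, now with x = e2, y = b e2, v the second row of \<open>V\<close> and
    u = (\<open>V $ 1 $ 2 / b\<close>, 0).\<close>
  define R :: mat2 where
    "R = vector [vector [V $ 1 $ 2 * V $ 2 $ 1 / b, V $ 1 $ 2 * V $ 2 $ 2 / b], vector [0, 0]]"
  have "R $ 1 $ 1 = V $ 1 $ 2 * V $ 2 $ 1 / b" "R $ 1 $ 2 = V $ 1 $ 2 * V $ 2 $ 2 / b"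
    "R $ 2 $ 1 = 0" "R $ 2 $ 2 = 0"
    by (simp_all add: R_def)
  note R = this
  have "det (diag2 0 b + t *\<^sub>R V + t\<^sup>2 *\<^sub>R R) = 0" for t
  proof -
    have "det (diag2 0 b + t *\<^sub>R V + t\<^sup>2 *\<^sub>R R) =
        t\<^sup>2 * (b * R $ 1 $ 1 - V $ 1 $ 2 * V $ 2 $ 1) + t ^ 3 * (V $ 2 $ 2 * R $ 1 $ 1 - V $ 2 $ 1 * R $ 1 $ 2)"
      using V R(3,4) by (simp add: det_2 algebra_simps power2_eq_square power3_eq_cube)
    also have "\<dots> = 0" using assms by (simp add: R)
    finally show ?thesis .
  qed
  then show "V \<in> tangent_cone rank_le1 (diag2 0 b)"
    by (intro tangent_cone_quadratic_curveI[where R = R]) (simp add: mem_rank_le1_iff)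
qed

section \<open>One step of the algorithms\<close>

lemma stat_measure_eq_norm:
  assumes "proj (tangent_cone rank_le1 X) (- grad f X) = {G}"
  shows "stat_measure f X = norm G"
  by (simp add: stat_measure_def assms)

text \<open>The first trial point already has rank at most one, so it is its own unique projection,
  and sufficient decrease holds there. Equal step bounds leave no choice of \<alpha>.\<close>

lemma P2GD_eq_singletonI:
  assumes "X \<in> rank_le1"
    and G: "proj (tangent_cone rank_le1 X) (- grad f X) = {G}" "G \<noteq> 0"
    and "X + \<alpha> *\<^sub>R G \<in> rank_le1"
    and "f (X + \<alpha> *\<^sub>R G) \<le> f X - c * \<alpha> * (norm G)\<^sup>2"
  shows "P2GD f \<alpha> \<alpha> \<beta> c X = {X + \<alpha> *\<^sub>R G}"
proof -
  have "backtrack f \<beta> c X G \<alpha> Y \<longleftrightarrow> Y = X + \<alpha> *\<^sub>R G" for Y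
    using assms(5) proj_self[OF assms(4)]
    \<comment> \<open>One unfolding is enough: \<open>shrink\<close> would need this same trial
      point to fail the test.\<close>
    by (subst backtrack.simps) (auto simp: stat_measure_eq_norm[OF G(1)])
  then show ?thesis
    using assms(1) G by (auto simp: P2GD_def stat_measure_eq_norm[OF G(1)])
qed

text \<open>Only \<open>j = 0\<close> is tried, so the step coincides with that of
  \<open>P2GD\<close>.\<close>

lemma P2GDR_full_rank_Delta:
  assumes "X \<in> rank_le1" "0 < stat_measure f X" "rank_Delta \<Delta> X = rank X"
    and "P2GD f \<alpha>lo \<alpha>hi \<beta> c X = {Y}"
  shows "P2GDR f \<alpha>lo \<alpha>hi \<beta> c \<Delta> X = {Y}"
proof -
  have "proj (rank_eq (rank X)) X = {X}"
    by (rule proj_self) (simp add: rank_eq_def)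
  then have P2GDR_eq: "P2GDR f \<alpha>lo \<alpha>hi \<beta> c \<Delta> X = {W. \<exists>(Xhat :: nat \<Rightarrow> mat2) Xtilde.
      (Xhat 0 = X \<and> Xtilde 0 \<in> P2GD f \<alpha>lo \<alpha>hi \<beta> c (Xhat 0)) \<and>
      is_arg_min f (\<lambda>V. V \<in> {Xtilde (0::nat)}) W}"
    using assms(1-3) by (simp add: P2GDR_def)
  have arg_min: "is_arg_min f (\<lambda>V. V \<in> {Y}) W \<longleftrightarrow> W = Y" for W
    by (auto simp: is_arg_min_def)
  show ?thesis
  proof (intro equalityI subsetI)
    fix W assume "W \<in> P2GDR f \<alpha>lo \<alpha>hi \<beta> c \<Delta> X"
    then obtain Xhat :: "nat \<Rightarrow> mat2" and Xtilde where *: "Xhat 0 = X"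
      "Xtilde 0 \<in> P2GD f \<alpha>lo \<alpha>hi \<beta> c (Xhat 0)" "is_arg_min f (\<lambda>V. V \<in> {Xtilde (0::nat)}) W"
      unfolding P2GDR_eq by blast
    then have "Xtilde 0 = Y" using assms(4) by simp
    with *(3) arg_min[of W] show "W \<in> {Y}" by simp
  next
    fix W assume "W \<in> {Y}"
    then show "W \<in> P2GDR f \<alpha>lo \<alpha>hi \<beta> c \<Delta> X"
      unfolding P2GDR_eq using assms(4) arg_min
      by (intro CollectI exI[of _ "\<lambda>_. X"] exI[of _ "\<lambda>_. Y"]) simp
  qed
qed

text \<open>Both \<open>j = 0\<close> and \<open>j = 1\<close> are tried; the zero matrix is the
  only one of rank 0, and its candidate wins by the last hypothesis.\<close>

lemma P2GDR_reduction_to_zero: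
  assumes "X \<in> rank_le1" "0 < stat_measure f X" "rank X = 1" "rank_Delta \<Delta> X = 0"
    and "P2GD f \<alpha>lo \<alpha>hi \<beta> c X = {Y}" "P2GD f \<alpha>lo \<alpha>hi \<beta> c 0 = {Z}" "f Z < f Y"
  shows "P2GDR f \<alpha>lo \<alpha>hi \<beta> c \<Delta> X = {Z}"
proof -
  have "proj (rank_eq 1) X = {X}"
    by (rule proj_self) (simp add: rank_eq_def assms)
  moreover have "proj (rank_eq 0) X = {0}"
    by (auto simp: rank_eq_def rank_eq_0 proj_def is_arg_min_def)
  moreover have "{0..1} = {0, 1::nat}" by auto
  ultimately have P2GDR_eq: "P2GDR f \<alpha>lo \<alpha>hi \<beta> c \<Delta> X = {W. \<exists>(Xhat :: nat \<Rightarrow> mat2) Xtilde.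
      (Xhat 0 = X \<and> Xtilde 0 \<in> P2GD f \<alpha>lo \<alpha>hi \<beta> c (Xhat 0)) \<and>
      (Xhat 1 = 0 \<and> Xtilde 1 \<in> P2GD f \<alpha>lo \<alpha>hi \<beta> c (Xhat 1)) \<and>
      is_arg_min f (\<lambda>V. V \<in> {Xtilde (0::nat), Xtilde 1}) W}"
    using assms(1-4) by (simp add: P2GDR_def conj_assoc)
  have arg_min: "is_arg_min f (\<lambda>V. V \<in> {Y, Z}) W \<longleftrightarrow> W = Z" for W
    using assms(7) by (auto simp: is_arg_min_def)
  show ?thesis
  proof (intro equalityI subsetI)
    fix W assume "W \<in> P2GDR f \<alpha>lo \<alpha>hi \<beta> c \<Delta> X"
    then obtain Xhat :: "nat \<Rightarrow> mat2" and Xtilde where *: "Xhat 0 = X" "Xhat 1 = 0"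
      "Xtilde 0 \<in> P2GD f \<alpha>lo \<alpha>hi \<beta> c (Xhat 0)" "Xtilde 1 \<in> P2GD f \<alpha>lo \<alpha>hi \<beta> c (Xhat 1)"
      "is_arg_min f (\<lambda>V. V \<in> {Xtilde (0::nat), Xtilde 1}) W"
      unfolding P2GDR_eq by blast
    then have "Xtilde 0 = Y" "Xtilde 1 = Z" using assms(5,6) by simp_all
    with *(5) arg_min[of W] show "W \<in> {Z}" by simp
  next
    fix W assume "W \<in> {Z}"
    then show "W \<in> P2GDR f \<alpha>lo \<alpha>hi \<beta> c \<Delta> X"
      unfolding P2GDR_eq using assms(5,6) arg_min
      by (intro CollectI exI[of _ "\<lambda>j. if j = 0 then X else 0"] exI[of _ "\<lambda>j. if j = 0 then Y else Z"])
        simp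
  qed
qed

section \<open>The objective function\<close>

definition objective :: "mat2 \<Rightarrow> real" where
  "objective Z = ((Z $ 1 $ 1 - 4)\<^sup>2 + 3 * (Z $ 2 $ 2 - 2)\<^sup>2 + (Z $ 1 $ 2 - Z $ 2 $ 1)\<^sup>2) / 2"

text \<open>The off-diagonal term is the square of a difference that vanishes at diagonal matrices,
  so it adds nothing to the gradient there.\<close>

lemma grad_objective_diag2: "grad objective (diag2 a b) = diag2 (a - 4) (3 * (b - 2))"
  unfolding grad_def
proof (rule the_equality)
  have [derivative_intros]: "((\<lambda>Z. Z $ i $ j) has_derivative (\<lambda>Z. Z $ i $ j)) (at (diag2 a b))" for i j
    by (rule bounded_linear_imp_has_derivative)
      (rule bounded_linear_compose[OF bounded_linear_vec_nth bounded_linear_vec_nth])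
  show G: "GDERIV objective (diag2 a b) :> diag2 (a - 4) (3 * (b - 2))"
    unfolding gderiv_def objective_def
    by (rule derivative_eq_intros refl | simp)+
      (simp add: fun_eq_iff inner_vec_def sum_2 field_simps)
  fix H assume "GDERIV objective (diag2 a b) :> H"
  with G have "(\<lambda>h. h \<bullet> H) = (\<lambda>h. h \<bullet> diag2 (a - 4) (3 * (b - 2)))"
    unfolding gderiv_def by (rule has_derivative_unique[rotated])
  then show "H = diag2 (a - 4) (3 * (b - 2))"
    using vector_eq_ldot[of H] by (simp only: fun_eq_iff)
qed

text \<open>The cone is a hyperplane, so projecting erases the (2,2) entry of the negative
  gradient.\<close>

lemma proj_tangent_cone_objective_left:
  assumes "a \<noteq> 0"
  shows "proj (tangent_cone rank_le1 (diag2 a 0)) (- grad objective (diag2 a 0)) = {diag2 (4 - a) 0}"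
  unfolding tangent_cone_rank_le1_diag2_left[OF assms] grad_objective_diag2
  by (rule proj_eq_if_orthogonal) (auto simp: inner_vec_def sum_2)

lemma proj_tangent_cone_objective_right:
  assumes "b \<noteq> 0"
  shows "proj (tangent_cone rank_le1 (diag2 0 b)) (- grad objective (diag2 0 b)) = {diag2 0 (3 * (2 - b))}"
  unfolding tangent_cone_rank_le1_diag2_right[OF assms] grad_objective_diag2
  by (rule proj_eq_if_orthogonal) (auto simp: inner_vec_def sum_2)

text \<open>At zero the cone is not linear; the projection of \<open>diag2 4 6\<close> keeps the
  larger entry.\<close>

lemma proj_tangent_cone_objective_zero:
  "proj (tangent_cone rank_le1 0) (- grad objective 0) = {diag2 0 6}"
proof -
  have "0 = diag2 0 0" "- diag2 (- 4) (- 6) = diag2 4 6" by (simp_all add: mat2_eq_iff)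
  then show ?thesis
    using proj_rank_le1_diag2[of 4 6] grad_objective_diag2[of 0 0]
    by (simp add: tangent_cone_rank_le1_zero)
qed

section \<open>The two kinds of steps\<close>

lemma stat_measure_right:
  assumes "b \<noteq> 0"
  shows "stat_measure objective (diag2 0 b) = 3 * \<bar>2 - b\<bar>"
  by (auto simp: stat_measure_eq_norm[OF proj_tangent_cone_objective_right[OF assms]] norm_diag2 abs_if)

lemma P2GDR_right:
  assumes "c \<le> 5 / 8" "1 < b" "b < 2"
  shows "P2GDR objective (1/4) (1/4) \<beta> c 1 (diag2 0 b) = {diag2 0 (3/2 + b/4)}"
proof (rule P2GDR_full_rank_Delta)
  let ?X = "diag2 0 b" and ?G = "diag2 0 (3 * (2 - b))"
  show mem: "?X \<in> rank_le1" by (simp add: mem_rank_le1_iff det_2)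
  show "0 < stat_measure objective ?X" using assms by (simp add: stat_measure_right)
  have rank: "rank ?X = 1"
    using assms by (intro rank_mat2_eq_1) (auto simp: det_2 mat2_eq_iff)
  have "{j \<in> {1..1}. singular_value j ?X > 1} = {1}"
    using assms by (auto simp: singular_value_def singular_values_diag2_right)
  then show "rank_Delta 1 ?X = rank ?X"
    by (simp add: rank_Delta_def rank)
  have step: "?X + (1/4) *\<^sub>R ?G = diag2 0 (3/2 + b/4)"
    by (simp add: mat2_eq_iff field_simps)
  \<comment> \<open>The step decreases the objective by \<open>45/32 * (2 - b)\<^sup>2\<close>, and
    the line search asks for \<open>9/4 * c * (2 - b)\<^sup>2\<close>; the quotient is 5/8.\<close>
  have "c * (2 - b)\<^sup>2 \<le> 5/8 * (2 - b)\<^sup>2"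
    using assms by (intro mult_right_mono) auto
  then have "objective (?X + (1/4) *\<^sub>R ?G) \<le> objective ?X - c * (1/4) * (norm ?G)\<^sup>2"
    unfolding step by (simp add: objective_def norm_diag2 power2_eq_square field_simps)
  moreover have "?X + (1/4) *\<^sub>R ?G \<in> rank_le1"
    unfolding step by (simp add: mem_rank_le1_iff det_2)
  moreover have "b \<noteq> 0" "?G \<noteq> 0"
    using assms by (auto simp: mat2_eq_iff)
  ultimately have "P2GD objective (1/4) (1/4) \<beta> c ?X = {?X + (1/4) *\<^sub>R ?G}"
    by (intro P2GD_eq_singletonI mem proj_tangent_cone_objective_right)
  then show "P2GD objective (1/4) (1/4) \<beta> c ?X = {diag2 0 (3/2 + b/4)}"
    unfolding step .
qed

lemma stat_measure_start: "stat_measure objective (diag2 1 0) = 3"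
  using stat_measure_eq_norm[OF proj_tangent_cone_objective_left[of 1]] by (simp add: norm_diag2)

lemma P2GDR_start:
  assumes "c \<le> 5 / 8"
  shows "P2GDR objective (1/4) (1/4) \<beta> c 1 (diag2 1 0) = {diag2 0 (3/2)}"
proof (rule P2GDR_reduction_to_zero)
  let ?X = "diag2 1 0"
  show mem: "?X \<in> rank_le1" by (simp add: mem_rank_le1_iff det_2)
  show "0 < stat_measure objective ?X" by (simp add: stat_measure_start)
  show rank: "rank ?X = 1"
    by (intro rank_mat2_eq_1) (auto simp: det_2 mat2_eq_iff)
  have "{j \<in> {1..1}. singular_value j ?X > 1} = {}"
    by (auto simp: singular_value_def singular_values_diag2_left)
  then show "rank_Delta 1 ?X = 0"
    by (simp only: rank_Delta_def rank Max_singleton)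
  have step: "?X + (1/4) *\<^sub>R diag2 3 0 = diag2 (7/4) 0"
    by (simp add: mat2_eq_iff)
  show "P2GD objective (1/4) (1/4) \<beta> c ?X = {diag2 (7/4) 0}"
    using assms proj_tangent_cone_objective_left[of 1]
    by (subst step[symmetric], intro P2GD_eq_singletonI mem)
      (auto simp: step mem_rank_le1_iff det_2 mat2_eq_iff objective_def norm_diag2 power2_eq_square)
  have step0: "0 + (1/4) *\<^sub>R diag2 0 6 = diag2 0 (3/2)"
    by (simp add: mat2_eq_iff)
  \<comment> \<open>The decrease is 45/8 and the requirement is \<open>9 * c\<close>, so the bound
    5/8 is tight here too.\<close>
  show "P2GD objective (1/4) (1/4) \<beta> c 0 = {diag2 0 (3/2)}"
    unfolding step0[symmetric] using assms
    by (intro P2GD_eq_singletonI proj_tangent_cone_objective_zero)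
      (auto simp: mem_rank_le1_iff det_2 mat2_eq_iff objective_def norm_diag2 power2_eq_square)
  \<comment> \<open>The two values are 67/8 and 273/32.\<close>
  show "objective (diag2 0 (3/2)) < objective (diag2 (7/4) 0)"
    by (simp add: objective_def power2_eq_square)
qed

section \<open>The iterates and their limit\<close>

theorem proposition4:
  fixes \<alpha> \<beta> c \<Delta> :: real and f :: "mat2 \<Rightarrow> real" and X :: "nat \<Rightarrow> mat2"
  assumes "\<alpha> = 1 / 4"
    and "0 < \<beta>" "\<beta> < 1"
    and "0 < c" "c \<le> 5 / 8"
    and "\<Delta> = 1"
    and "\<And>Z. f Z = ((Z $ 1 $ 1 - 4)\<^sup>2 + 3 * (Z $ 2 $ 2 - 2)\<^sup>2 + (Z $ 1 $ 2 - Z $ 2 $ 1)\<^sup>2) / 2"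
    and "X 0 = diag2 1 0"
    and "\<And>i. i \<noteq> 0 \<Longrightarrow> X i = diag2 0 (2 - 2 * (1 - 3 * \<alpha>) ^ i)"
  shows "P2GDR_produces f \<alpha> \<alpha> \<beta> c \<Delta> (diag2 1 0) X \<and>
    X \<longlonglongrightarrow> diag2 0 2 \<and>
    (\<lambda>i. stat_measure f (X i)) \<longlonglongrightarrow> 0 \<and>
    stat_measure f (diag2 0 2) = 0"
proof -
  have f: "f = objective"
    by (simp add: fun_eq_iff assms(7) objective_def)
  \<comment> \<open>Here \<open>1/4\<close> is \<open>1 - 3 * \<alpha>\<close>. As
    \<open>b 0 = 0\<close> does not describe \<open>X 0\<close>, the facts linking \<open>X\<close>
    to \<open>b\<close> start at \<open>Suc i\<close>.\<close>
  define b :: "nat \<Rightarrow> real" where "b i = 2 - 2 * (1/4) ^ i" for i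
  have X: "X (Suc i) = diag2 0 (b (Suc i))" for i
    using assms(9)[of "Suc i"] assms(1) by (simp add: b_def)
  \<comment> \<open>The lower bound keeps the singular value above \<Delta>; the upper one keeps the
    iterate nonstationary.\<close>
  have b_bounds: "1 < b (Suc i)" "b (Suc i) < 2" for i
    using power_le_one[of "1/4::real" i] by (simp_all add: b_def)
  have b_lim: "b \<longlonglongrightarrow> 2"
  proof -
    have "b \<longlonglongrightarrow> 2 - 2 * 0"
      unfolding b_def by (intro tendsto_intros LIMSEQ_power_zero) auto
    then show ?thesis by simp
  qed
  have "0 < stat_measure f (X i) \<and> P2GDR f \<alpha> \<alpha> \<beta> c \<Delta> (X i) = {X (Suc i)}" for i
  proof (cases i)
    case 0
    then show ?thesis
      using P2GDR_start[OF assms(5)] X[of 0] by (simp add: f b_def stat_measure_start assms(1,6,8))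
  next
    case (Suc k)
    \<comment> \<open>Each step divides the distance to 2 by four.\<close>
    have "3/2 + b (Suc k) / 4 = b (Suc (Suc k))"
      by (simp add: b_def field_simps)
    then show ?thesis
      using P2GDR_right[OF assms(5) b_bounds[of k]] b_bounds[of k]
      by (simp add: f Suc X stat_measure_right assms(1,6))
  qed
  then have "P2GDR_produces f \<alpha> \<alpha> \<beta> c \<Delta> (diag2 1 0) X"
    by (simp add: P2GDR_produces_def assms(8) mem_rank_le1_iff det_2)
  moreover have "X \<longlonglongrightarrow> diag2 0 2"
  proof -
    have "y *\<^sub>R diag2 0 1 = diag2 0 y" for y by (simp add: mat2_eq_iff)
    then have "(\<lambda>i. X (Suc i)) \<longlonglongrightarrow> diag2 0 2"
      unfolding X using tendsto_scaleR[OF LIMSEQ_Suc[OF b_lim] tendsto_const[of "diag2 0 1"]]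
      by (simp only:)
    then show ?thesis by (rule LIMSEQ_imp_Suc)
  qed
  moreover have "(\<lambda>i. stat_measure f (X i)) \<longlonglongrightarrow> 0"
  proof -
    have "stat_measure f (X (Suc i)) = 3 * \<bar>2 - b (Suc i)\<bar>" for i
      using b_bounds(1)[of i] by (simp add: f X stat_measure_right)
    moreover have "(\<lambda>i. 3 * \<bar>2 - b (Suc i)\<bar>) \<longlonglongrightarrow> 3 * \<bar>2 - 2\<bar>"
      by (intro tendsto_intros LIMSEQ_Suc b_lim)
    ultimately have "(\<lambda>i. stat_measure f (X (Suc i))) \<longlonglongrightarrow> 0" by simp
    then show ?thesis by (rule LIMSEQ_imp_Suc)
  qed
  moreover have "stat_measure f (diag2 0 2) = 0"
    by (simp add: f stat_measure_right)
  ultimately show ?thesis by blast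
qed

end
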